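(* Let $a,b\in\mathbb{Q}$ with $a\neq 0$, and let $f_n(x)=\frac1a\left(T_n(ax+b)-b\right)$ for integers $n\ge 0$. For any positive integers $m<n$, put $k=\left[\frac nm\right]$. Then the quotient $q_{m,n}(x)$ and the remainder $r_{m,n}(x)$ of the Euclidean division of $f_n(x)$ by $f_m(x)$ in $\mathbb{Q}[x]$ are \[ q_{m,n}(x)=2a\sum_{i=1}^k c_i f_{n-im}(x)+d_{m,n}, \] \[ r_{m,n}(x)=\begin{cases}\dfrac1a\left(bc_k-b-c_{k-1}\right) & \text{if } n=km,\\[2mm] c_{k+1}f_{n-km}(x)-c_kf_{(k+1)m-n}(x)+\dfrac ba\left(c_{k+1}-c_k-1\right) & \text{if } m\nmid n,\end{cases} \] where $c_i=U_{i-1}(b)$ for $i\ge1$, and \[ d_{m,n}=\begin{cases}\displaystyle 2b\sum_{i=1}^k c_i-c_k & \text{if } n=km,\\[2mm] \displaystyle 2b\sum_{i=1}^{k}c_i & \text{if } m\nmid n.\end{cases} \]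
   Context: $[\cdot]$ is the integer part. $T_n$ is the Chebyshev polynomial of the first kind: $T_0=1$, $T_1=x$, $T_n=2xT_{n-1}-T_{n-2}$ for $n\ge2$; $U_n$ is the Chebyshev polynomial of the second kind: $U_0=1$, $U_1=2x$, $U_n=2xU_{n-1}-U_{n-2}$ for $n\ge2$. In particular $f_0(x)=\frac{1-b}{a}$. *)

theory Defs
  imports "HOL-Computational_Algebra.Polynomial"
begin

fun chebyshev_T :: "nat \<Rightarrow> 'a::comm_ring_1 poly" where
  "chebyshev_T 0 = 1"
| "chebyshev_T (Suc 0) = [:0, 1:]"
| "chebyshev_T (Suc (Suc n)) = [:0, 2:] * chebyshev_T (Suc n) - chebyshev_T n"

fun chebyshev_U :: "nat \<Rightarrow> 'a::comm_ring_1 poly" where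
  "chebyshev_U 0 = 1"
| "chebyshev_U (Suc 0) = [:0, 2:]"
| "chebyshev_U (Suc (Suc n)) = [:0, 2:] * chebyshev_U (Suc n) - chebyshev_U n"

text \<open>\<open>f\<^sub>n(x) = (T\<^sub>n(ax + b) - b) / a\<close>\<close>

definition cheb_f :: "rat \<Rightarrow> rat \<Rightarrow> nat \<Rightarrow> rat poly" where
  "cheb_f a b n = smult (1 / a) (pcompose (chebyshev_T n) [:b, a:] - [:b:])"

end

theory Submission imports Defs begin

text \<open>
  Put \<open>t\<^sub>j = T\<^sub>j(ax + b)\<close> and \<open>s\<^sub>i = t\<^bsub>\<bar>n - im\<bar>\<^esub>\<close>. The product formula
  \<open>2 T\<^sub>m T\<^sub>j = T\<^bsub>j+m\<^esub> + T\<^bsub>\<bar>j-m\<bar>\<^esub>\<close> gives \<open>2 (t\<^sub>m - b) s\<^sub>i = s\<^bsub>i-1\<^esub> - 2b s\<^sub>i + s\<^bsub>i+1\<^esub>\<close> for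
  \<open>1 \<le> i \<le> k\<close>. The weights \<open>c\<^sub>i = U\<^bsub>i-1\<^esub>(b)\<close> solve the adjoint recurrence with \<open>c\<^sub>0 = 0\<close> and
  \<open>c\<^sub>1 = 1\<close>, so the weighted sum of these identities telescopes to
  \<open>s\<^sub>0 + c\<^sub>k s\<^bsub>k+1\<^esub> - c\<^bsub>k+1\<^esub> s\<^sub>k\<close>, where \<open>s\<^sub>0 = t\<^sub>n\<close>. If \<open>m\<close> does not divide \<open>n\<close>, both \<open>s\<^sub>k\<close> and
  \<open>s\<^bsub>k+1\<^esub>\<close> have degree less than \<open>m\<close>; otherwise \<open>s\<^bsub>k+1\<^esub> = t\<^sub>m\<close> must be reduced once more,
  which accounts for the extra term \<open>- c\<^sub>k\<close> in \<open>d\<close>.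
\<close>

lemma div_mod_poly_unique:
  fixes p q r :: "'a::field poly"
  assumes "degree r < degree p"
  shows "(q * p + r) div p = q" and "(q * p + r) mod p = r"
proof -
  have "p \<noteq> 0" using assms by auto
  then show "(q * p + r) div p = q" "(q * p + r) mod p = r"
    using assms by (simp_all add: div_poly_less mod_poly_less)
qed

text \<open>The recurrence is applied to the first factor only. The second index is then read as
  \<open>Suc m + Suc j\<close> and as \<open>m + Suc (Suc j)\<close>, so \<open>j\<close> must stay
  arbitrary.\<close>

lemma chebyshev_T_mult:
  "2 * chebyshev_T m * chebyshev_T (m + j) = chebyshev_T (2 * m + j) + chebyshev_T j"
proof (induction m arbitrary: j rule: chebyshev_T.induct)
  case 1
  show ?case by simp
next
  case 2
  show ?case by (simp add: algebra_simps numeral_poly)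
next
  case (3 m)
  let ?X = "[:0, 2:] :: 'a poly"
  have "2 * chebyshev_T (Suc (Suc m)) * chebyshev_T (Suc (Suc m) + j)
      = ?X * (2 * chebyshev_T (Suc m) * chebyshev_T (Suc m + Suc j))
        - 2 * chebyshev_T m * chebyshev_T (m + Suc (Suc j))"
    by (simp add: algebra_simps del: mult_pCons_left mult_pCons_right)
  also have "\<dots> = ?X * (chebyshev_T (2 * Suc m + Suc j) + chebyshev_T (Suc j))
        - (chebyshev_T (2 * m + Suc (Suc j)) + chebyshev_T (Suc (Suc j)))"
    by (simp only: 3)
  also have "\<dots> = chebyshev_T (2 * Suc (Suc m) + j) + chebyshev_T j"
    by (simp add: algebra_simps del: mult_pCons_left mult_pCons_right)
  finally show ?case .
qed

lemma degree_chebyshev_T: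
  "degree (chebyshev_T n :: 'a::{idom,ring_char_0} poly) = n"
proof (induction n rule: chebyshev_T.induct)
  case (3 n)
  let ?X = "[:0, 2:] :: 'a poly"
  have "chebyshev_T (Suc n) \<noteq> (0 :: 'a poly)"
    using 3 by auto
  then have "degree (?X * chebyshev_T (Suc n)) = Suc (Suc n)"
    using 3 by (subst degree_mult_eq) auto
  then have "degree (?X * chebyshev_T (Suc n) - chebyshev_T n) = Suc (Suc n)"
    using 3 by (subst diff_conv_add_uminus, subst degree_add_eq_left) auto
  then show ?case by (simp del: mult_pCons_left)
qed auto

lemma degree_cheb_f:
  assumes "a \<noteq> 0"
  shows "degree (cheb_f a b n) = n"
proof (cases "n = 0")
  case False
  have "degree (pcompose (chebyshev_T n) [:b, a:]) = n"
    using assms by (simp add: degree_pcompose degree_chebyshev_T)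
  then have "degree (pcompose (chebyshev_T n) [:b, a:] - [:b:]) = n"
    using False by (subst diff_conv_add_uminus, subst degree_add_eq_left) auto
  then show ?thesis
    using assms by (simp add: cheb_f_def)
qed (simp add: cheb_f_def pcompose_1 one_pCons)

text \<open>Summation by parts: the coefficient of each interior \<open>s i\<close> vanishes by the
  recurrence for \<open>e\<close>, so \<open>s\<close> may be arbitrary.\<close>

lemma sum_telescope_adjoint_recurrence:
  fixes e s :: "nat \<Rightarrow> 'a::comm_ring_1"
  assumes "e 0 = 0" and "e 1 = 1"
    and "\<And>i. e (Suc (Suc i)) = p * e (Suc i) - e i"
  shows "(\<Sum>i = 1..k. e i * (s (i - 1) - p * s i + s (i + 1)))
    = s 0 + e k * s (k + 1) - e (k + 1) * s k"
proof (induction k)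
  case (Suc k)
  then show ?case
    by (simp add: assms(3)) (simp add: algebra_simps)
qed (use assms in simp)

lemma chebyshev_T_pcompose_division:
  fixes p :: "'a::comm_ring_1 poly"
  defines "t \<equiv> \<lambda>j. pcompose (chebyshev_T j) p"
  assumes e: "e 0 = 0" "e 1 = 1" "\<And>i. e (Suc (Suc i)) = 2 * b * e (Suc i) - e i"
    and "k * m \<le> n" and "n \<le> (k + 1) * m"
  shows "t n = (t m - [:b:]) * (2 * (\<Sum>i = 1..k. smult (e i) (t (n - i * m))))
    + smult (e (k + 1)) (t (n - k * m)) - smult (e k) (t ((k + 1) * m - n))"
proof -
  \<comment> \<open>Both truncated differences are exact, since
    \<open>k * m \<le> n \<le> (k + 1) * m\<close>.\<close>
  define s where "s i = t (if i \<le> k then n - i * m else i * m - n)" for i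
  have step: "(t m - [:b:]) * (2 * t (n - i * m)) = s (i - 1) - [:2 * b:] * s i + s (i + 1)"
    if i: "i \<in> {1..k}" for i
  proof -
    have prod: "2 * t u * t (u + j) = t (2 * u + j) + t j" for u j
      using arg_cong[OF chebyshev_T_mult[of u j], of "\<lambda>q. pcompose q p"]
      by (simp add: t_def pcompose_mult pcompose_add pcompose_smult numeral_poly)
    have im: "i * m \<le> k * m" using i by simp
    have prev: "s (i - 1) = t (n - i * m + m)"
    proof -
      have "n - (i - 1) * m = n - i * m + m"
        using i im assms(5) by (cases i) auto
      moreover have "i - 1 \<le> k" using i by auto
      ultimately show ?thesis by (simp add: s_def)
    qed
    have "2 * t m * t (n - i * m) = s (i - 1) + s (i + 1)"
    proof (cases "i = k")
      \<comment> \<open>The reflection happens here: \<open>n - k * m \<le> m\<close>, so the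
        factors swap roles in the product formula.\<close>
      case True
      define u v where "u = n - i * m" and "v = (k + 1) * m - n"
      have "m = u + v"
        using True assms by (simp add: u_def v_def)
      moreover have "2 * t (u + v) * t u = t (u + (u + v)) + t v"
        using prod[of u v] by (simp only: mult_2[of u] add.assoc mult.assoc mult.commute[of "t u"])
      ultimately have "2 * t m * t u = t (u + m) + t v"
        by (simp only:)
      moreover have "s (i + 1) = t v"
        using True by (simp add: s_def v_def)
      ultimately show ?thesis
        by (simp only: prev u_def)
    next
      case False
      then have ik: "i + 1 \<le> k" using i by simp
      then have "(i + 1) * m \<le> k * m" by (rule mult_right_mono) simp
      moreover define v where "v = n - (i + 1) * m"
      ultimately have "n - i * m = m + v"
        using assms by (simp add: algebra_simps)
      moreover have "s (i + 1) = t v"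
        using ik by (simp add: s_def v_def)
      ultimately show ?thesis
        using prod[of m v] by (simp only: prev mult_2[of m] add_ac)
    qed
    moreover have "s i = t (n - i * m)"
      using i by (simp add: s_def)
    ultimately show ?thesis
      by (simp add: numeral_poly smult_diff_right algebra_simps)
  qed
  have "(t m - [:b:]) * (2 * (\<Sum>i = 1..k. smult (e i) (t (n - i * m))))
      = (\<Sum>i = 1..k. [:e i:] * ((t m - [:b:]) * (2 * t (n - i * m))))"
    by (simp add: sum_distrib_left mult_ac)
  also have "\<dots> = (\<Sum>i = 1..k. [:e i:] * (s (i - 1) - [:2 * b:] * s i + s (i + 1)))"
    using step by (intro sum.cong) auto
  also have "\<dots> = s 0 + [:e k:] * s (k + 1) - [:e (k + 1):] * s k"
    using e by (intro sum_telescope_adjoint_recurrence) (auto simp: algebra_simps)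
  finally show ?thesis
    by (simp add: s_def algebra_simps)
qed

theorem proposition2p6:
  fixes a b :: rat and m n k :: nat and f :: "nat \<Rightarrow> rat poly" and c :: "nat \<Rightarrow> rat" and d :: rat
  assumes "a \<noteq> 0"
    and f: "f = cheb_f a b"
    and "0 < m" and "m < n"
    and k: "k = n div m"
    and c: "\<And>i. 1 \<le> i \<Longrightarrow> c i = poly (chebyshev_U (i - 1)) b"
    and d: "d = (if n = k * m then 2 * b * (\<Sum>i = 1..k. c i) - c k
                 else 2 * b * (\<Sum>i = 1..k. c i))"
  shows "f n div f m = smult (2 * a) (\<Sum>i = 1..k. smult (c i) (f (n - i * m))) + [:d:] \<and>
         f n mod f m =
           (if n = k * m then [:1 / a * (b * c k - b - c (k - 1)):]
            else smult (c (k + 1)) (f (n - k * m)) - smult (c k) (f ((k + 1) * m - n))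
                 + [:b / a * (c (k + 1) - c k - 1):])"
    (is "_ div _ = ?Q \<and> _ mod _ = ?R")
proof -
  define t where "t j = pcompose (chebyshev_T j) [:b, a:]" for j
  \<comment> \<open>The hypotheses leave \<open>c 0\<close> unspecified; the recurrence needs the value \<open>0\<close>.\<close>
  define e where "e = c(0 := 0)"
  have e_rec: "e (Suc (Suc i)) = 2 * b * e (Suc i) - e i" for i
    by (cases i) (simp_all add: e_def c algebra_simps)
  have e01: "e 0 = 0" "e 1 = 1"
    by (simp_all add: e_def c)
  have km: "k * m \<le> n" "n < (k + 1) * m"
    using k \<open>0 < m\<close> by (auto simp: dividend_less_div_times)
  have k1: "1 \<le> k"
    using k \<open>0 < m\<close> \<open>m < n\<close> by (simp add: Suc_le_eq div_greater_zero_iff)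
  define S where "S = (\<Sum>i = 1..k. smult (c i) (t (n - i * m)))"
  have tn: "t n = (t m - [:b:]) * (2 * S)
      + smult (c (k + 1)) (t (n - k * m)) - smult (c k) (t ((k + 1) * m - n))"
  proof -
    have "(\<Sum>i = 1..k. smult (e i) (t (n - i * m))) = S"
      unfolding S_def by (intro sum.cong) (auto simp: e_def)
    then show ?thesis
      using chebyshev_T_pcompose_division[of e b k m n "[:b, a:]", folded t_def]
        e01 e_rec km k1 by (simp add: e_def)
  qed
  have f_t: "f j = smult (1 / a) (t j - [:b:])" for j
    by (simp add: f cheb_f_def t_def)
  have t_f: "t j = smult a (f j) + [:b:]" for j
    using \<open>a \<noteq> 0\<close> by (simp add: f_t)
  define C where "C = (\<Sum>i = 1..k. c i)"
  \<comment> \<open>Replacing each \<open>t j\<close> by \<open>a * f j + b\<close> adds the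
    constant \<open>2 * b * C\<close> to \<open>2 * S\<close>.\<close>
  have Q: "?Q = 2 * S + [:d - 2 * b * C:]"
  proof -
    have "(\<Sum>i = 1..l. smult (c i) (t (n - i * m)))
        = smult a (\<Sum>i = 1..l. smult (c i) (f (n - i * m))) + [:b * (\<Sum>i = 1..l. c i):]" for l
      by (induction l) (simp_all add: t_f smult_add_right algebra_simps)
    then have "S = smult a (\<Sum>i = 1..k. smult (c i) (f (n - i * m))) + [:b * C:]"
      unfolding S_def C_def .
    then show ?thesis
      by (simp add: numeral_poly smult_add_right algebra_simps)
  qed
  have fn: "f n = (2 * S) * f m
      + smult (1 / a) (smult (c (k + 1)) (t (n - k * m)) - smult (c k) (t ((k + 1) * m - n)) - [:b:])"
    using \<open>a \<noteq> 0\<close> by (simp add: f_t tn smult_add_right smult_diff_right algebra_simps)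
  have eq: "f n = ?Q * f m + ?R"
  proof (cases "n = k * m")
    case True
    \<comment> \<open>Thus \<open>k \<ge> 2\<close>, and \<open>c (k - 1)\<close> is not the
      unspecified value \<open>c 0\<close>.\<close>
    then have "k \<noteq> 1" using \<open>m < n\<close> by auto
    then obtain j where "k = Suc (Suc j)"
      using k1 by (cases k rule: chebyshev_T.cases) simp_all
    then have ck: "c (k + 1) = 2 * b * c k - c (k - 1)"
      using e_rec[of "Suc j"] by (simp add: e_def)
    \<comment> \<open>The indices are 0 and \<open>m\<close>; the second term contains
      \<open>f m\<close> and moves \<open>- c k\<close> into the quotient.\<close>
    have ts: "t (n - k * m) = 1" "t ((k + 1) * m - n) = smult a (f m) + [:b:]"
      using True t_f[of m] by (simp_all add: t_def pcompose_1)
    have D: "d - 2 * b * C = - c k"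
      using True by (simp add: d C_def)
    have R: "?R = [:1 / a * (b * c k - b - c (k - 1)):]"
      using True by simp
    \<comment> \<open>Over an infinite field the identity can be checked by evaluation.\<close>
    show ?thesis
      unfolding Q fn R unfolding ck ts D using \<open>a \<noteq> 0\<close>
      by (intro poly_eq_poly_eq_iff[THEN iffD1] ext) (simp add: field_simps)
  next
    case False
    then have D: "d - 2 * b * C = 0"
      by (simp add: d C_def)
    have R: "?R = smult (c (k + 1)) (f (n - k * m)) - smult (c k) (f ((k + 1) * m - n))
        + [:b / a * (c (k + 1) - c k - 1):]"
      using False by simp
    show ?thesis
      unfolding Q fn R unfolding D t_f using \<open>a \<noteq> 0\<close>
      by (intro poly_eq_poly_eq_iff[THEN iffD1] ext) (simp add: field_simps)
  qed
  have deg: "degree (f j) = j" for j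
    using \<open>a \<noteq> 0\<close> by (simp add: f degree_cheb_f)
  have "degree ?R < m"
  proof (cases "n = k * m")
    case False
    \<comment> \<open>The second bound needs \<open>k * m < n\<close> strictly, hence
      non-divisibility.\<close>
    then have "n - k * m < m" "(k + 1) * m - n < m"
      using km by auto
    then show ?thesis
      using False \<open>0 < m\<close> deg
      by (auto intro!: degree_add_less degree_diff_less le_less_trans[OF degree_smult_le])
  qed (use \<open>0 < m\<close> in auto)
  then have "degree ?R < degree (f m)"
    by (simp only: deg)
  then have "(?Q * f m + ?R) div f m = ?Q" "(?Q * f m + ?R) mod f m = ?R"
    by (rule div_mod_poly_unique)+
  then show ?thesis
    unfolding eq by blast
qed

end
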